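(* Let $f\colon X\to\mathbb{R}$ be a filter on a Lefschetz complex, and let $\Phi$ be a linear order on $\mathrm{BD}(f)$. Then $\Phi$ is a shallow order of $f$ if and only if it is a linear extension of the depth poset $\mathcal{D}_f$.
   Context: Fix a field $\mathbb{F}$. A Lefschetz complex is a triple $(X,\dim,\kappa)$ with $X$ a finite set (of cells), $\dim\colon X\to\mathbb{Z}$, and an incidence map $\kappa\colon X\times X\to\mathbb{F}$ such that $\sum_{y\in X}\kappa(z,y)\kappa(y,x)=0$ for all $z,x\in X$, and $\kappa(y,x)\neq 0$ only if $\dim y=\dim x+1$. If $\kappa(y,x)\ne 0$, then $x$ is a facet of $y$ and $y$ is a cofacet of $x$. A filter on $X$ is an injective map $f\colon X\to\mathbb{R}$ with $f(x)<f(y)$ whenever $x$ is a facet of $y$. Birth-death pairs: order $X$ by $f$ and let $\Delta$ be the matrix with rows and columns indexed by $X$ in this order, $\Delta[x,y]=\kappa(y,x)$. A reduced form of $\Delta$ is a matrix $R=\Delta\cdot V$ with $V-\mathrm{Id}$ strictly upper triangular and such that the pivots (lowest non-zero entries) of the non-zero columns of $R$ lie in pairwise different rows. $\mathrm{BD}(f)$ is the set of pairs $(s,t)\in X\times X$ such that column $t$ of $R$ is non-zero and its pivot is in row $s$; this does not depend on the choice of $R$. Shallow pairs: $\mathrm{SH}(f)$ is the set of pairs $(s,t)$ such that $s$ is a facet of $t$, $f(x)\le f(s)$ for all facets $x$ of $t$, and $f(y)\ge f(t)$ for all cofacets $y$ of $s$. One has $\mathrm{SH}(f)\subseteq\mathrm{BD}(f)$.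 Cancellation: if $s$ is a facet of $t$, the quotient of $X$ by $(s,t)$ is the Lefschetz complex with cells $X\setminus\{s,t\}$, restricted dimension map, and incidence map $\kappa'(y,x)=\kappa(y,x)-\kappa(t,s)^{-1}\kappa(y,s)\kappa(t,x)$. If $(s,t)\in\mathrm{SH}(f)$, the restriction of $f$ is a filter on the quotient. Shallow orders: let $n=\#\mathrm{BD}(f)$. A shallow (cancellation) order of $f$ is an enumeration $\Phi=(\varphi_1,\dots,\varphi_n)$ of $\mathrm{BD}(f)$ such that, setting $X_0=X$, $f_0=f$, and letting $X_i$ be the quotient of $X_{i-1}$ by $\varphi_i$ and $f_i=f|_{X_i}$, one has $\varphi_i\in\mathrm{SH}(f_{i-1})$ for $i=1,\dots,n$. Enumerations are identified with linear orders via $\varphi_i\le_\Phi\varphi_j\iff i\le j$. Depth poset: $\mathcal{D}_f$ is the partial order on $\mathrm{BD}(f)$ that is the intersection of all shallow orders of $f$: $\chi\le_f\xi$ iff $\chi\le_\Phi\xi$ for every shallow order $\Phi$ of $f$. A linear extension of $\mathcal{D}_f$ is a linear order on $\mathrm{BD}(f)$ containing $\mathcal{D}_f$ as a relation. *)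

theory Defs
  imports Complex_Main
begin

(* Only the values of the three maps on the cells are meaningful; every notion below
   inspects them on the cells only. inc L y x is the incidence coefficient kappa(y,x). *)
record ('a, 'k) incidence_complex =
  cells :: "'a set"
  cdim :: "'a \<Rightarrow> int"
  inc :: "'a \<Rightarrow> 'a \<Rightarrow> 'k"

definition lefschetz_complex :: "('a, 'k::field) incidence_complex \<Rightarrow> bool" where
  "lefschetz_complex L \<longleftrightarrow>
     finite (cells L) \<and>
     (\<forall>z\<in>cells L. \<forall>x\<in>cells L. (\<Sum>y\<in>cells L. inc L z y * inc L y x) = 0) \<and>
     (\<forall>y\<in>cells L. \<forall>x\<in>cells L. inc L y x \<noteq> 0 \<longrightarrow> cdim L y = cdim L x + 1)"

definition facet :: "('a, 'k::field) incidence_complex \<Rightarrow> 'a \<Rightarrow> 'a \<Rightarrow> bool" where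
  "facet L x y \<longleftrightarrow> x \<in> cells L \<and> y \<in> cells L \<and> inc L y x \<noteq> 0"

abbreviation cofacet :: "('a, 'k::field) incidence_complex \<Rightarrow> 'a \<Rightarrow> 'a \<Rightarrow> bool" where
  "cofacet L y x \<equiv> facet L x y"

definition complex_filter :: "('a, 'k::field) incidence_complex \<Rightarrow> ('a \<Rightarrow> real) \<Rightarrow> bool" where
  "complex_filter L f \<longleftrightarrow>
     inj_on f (cells L) \<and> (\<forall>x y. facet L x y \<longrightarrow> f x < f y)"

(* Matrices have rows and columns indexed directly by the cells, the cells being ordered by f;
   M x y is the entry in row x and column y. *)
definition boundary_matrix :: "('a, 'k::field) incidence_complex \<Rightarrow> 'a \<Rightarrow> 'a \<Rightarrow> 'k" where
  "boundary_matrix L x y = inc L y x"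

definition strictly_upper ::
  "('a, 'k::field) incidence_complex \<Rightarrow> ('a \<Rightarrow> real) \<Rightarrow> ('a \<Rightarrow> 'a \<Rightarrow> 'k) \<Rightarrow> bool" where
  "strictly_upper L f M \<longleftrightarrow>
     (\<forall>x\<in>cells L. \<forall>y\<in>cells L. M x y \<noteq> 0 \<longrightarrow> f x < f y)"

(* Column t of M is non-zero and its lowest non-zero entry is in row s. *)
definition pivot ::
  "('a, 'k::field) incidence_complex \<Rightarrow> ('a \<Rightarrow> real) \<Rightarrow> ('a \<Rightarrow> 'a \<Rightarrow> 'k) \<Rightarrow> 'a \<Rightarrow> 'a \<Rightarrow> bool" where
  "pivot L f M s t \<longleftrightarrow>
     s \<in> cells L \<and> t \<in> cells L \<and> M s t \<noteq> 0 \<and>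
     (\<forall>x\<in>cells L. f s < f x \<longrightarrow> M x t = 0)"

definition reduced_form ::
  "('a, 'k::field) incidence_complex \<Rightarrow> ('a \<Rightarrow> real) \<Rightarrow> ('a \<Rightarrow> 'a \<Rightarrow> 'k) \<Rightarrow> bool" where
  "reduced_form L f R \<longleftrightarrow>
     (\<exists>V. strictly_upper L f (\<lambda>x y. V x y - (if x = y then 1 else 0)) \<and>
          (\<forall>x\<in>cells L. \<forall>y\<in>cells L.
             R x y = (\<Sum>z\<in>cells L. boundary_matrix L x z * V z y))) \<and>
     (\<forall>s t t'. pivot L f R s t \<and> pivot L f R s t' \<longrightarrow> t = t')"

(* A reduced form exists, and its pivots do not depend on the choice of R, so the existential
   quantifier amounts to fixing any one reduced form. *)
definition BD :: "('a, 'k::field) incidence_complex \<Rightarrow> ('a \<Rightarrow> real) \<Rightarrow> ('a \<times> 'a) set" where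
  "BD L f = {(s, t). \<exists>R. reduced_form L f R \<and> pivot L f R s t}"

definition SH :: "('a, 'k::field) incidence_complex \<Rightarrow> ('a \<Rightarrow> real) \<Rightarrow> ('a \<times> 'a) set" where
  "SH L f = {(s, t). facet L s t \<and>
     (\<forall>x. facet L x t \<longrightarrow> f x \<le> f s) \<and>
     (\<forall>y. cofacet L y s \<longrightarrow> f y \<ge> f t)}"

definition quotient ::
  "('a, 'k::field) incidence_complex \<Rightarrow> 'a \<times> 'a \<Rightarrow> ('a, 'k) incidence_complex" where
  "quotient L = (\<lambda>(s, t).
     \<lparr>cells = cells L - {s, t},
      cdim = cdim L,
      inc = (\<lambda>y x. inc L y x - inverse (inc L t s) * inc L y s * inc L t x)\<rparr>)"

(* With 0-based list indices, the complex X_i is foldl quotient L (take i phi), and phi ! i is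
   cancelled in it. The filter on X_i is f itself, evaluated only on the remaining cells. *)
definition shallow_enumeration ::
  "('a, 'k::field) incidence_complex \<Rightarrow> ('a \<Rightarrow> real) \<Rightarrow> ('a \<times> 'a) list \<Rightarrow> bool" where
  "shallow_enumeration L f \<phi> \<longleftrightarrow>
     distinct \<phi> \<and> set \<phi> = BD L f \<and>
     (\<forall>i<length \<phi>. \<phi> ! i \<in> SH (foldl quotient L (take i \<phi>)) f)"

definition enumeration_order :: "'b list \<Rightarrow> 'b rel" where
  "enumeration_order xs = {(xs ! i, xs ! j) | i j. i \<le> j \<and> j < length xs}"

definition shallow_order ::
  "('a, 'k::field) incidence_complex \<Rightarrow> ('a \<Rightarrow> real) \<Rightarrow> ('a \<times> 'a) rel \<Rightarrow> bool" where
  "shallow_order L f \<Phi> \<longleftrightarrow>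
     (\<exists>\<phi>. shallow_enumeration L f \<phi> \<and> \<Phi> = enumeration_order \<phi>)"

definition depth_poset ::
  "('a, 'k::field) incidence_complex \<Rightarrow> ('a \<Rightarrow> real) \<Rightarrow> ('a \<times> 'a) rel" where
  "depth_poset L f =
     {(\<chi>, \<xi>). \<chi> \<in> BD L f \<and> \<xi> \<in> BD L f \<and>
        (\<forall>\<Phi>. shallow_order L f \<Phi> \<longrightarrow> (\<chi>, \<xi>) \<in> \<Phi>)}"

definition linear_extension :: "'b set \<Rightarrow> 'b rel \<Rightarrow> 'b rel \<Rightarrow> bool" where
  "linear_extension A r l \<longleftrightarrow> linear_order_on A l \<and> r \<subseteq> l"

end

theory Submission imports Defs begin

text \<open>
  Why every linear extension of the depth poset is a shallow order.

  Call a list of pairs a cancellation word if each of its entries is shallow in the quotient by the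
  entries before it. Three local facts about shallow pairs carry the proof.
  \<^item> Cancelling a shallow pair leaves every shallow pair disjoint from it shallow
    (\<open>shallow_persists\<close>).
  \<^item> Two disjoint shallow pairs may be cancelled in either order, with the same quotient
    (\<open>quotient_commute\<close>).
  \<^item> Of two disjoint shallow pairs, at most one makes a given non-shallow pair shallow when it is
    cancelled (\<open>unique_unlocking\<close>). Indeed, suppose that \<open>(s, t)\<close> fails to be shallow because, say,
    the last facet \<open>x\<close> of \<open>t\<close> comes after \<open>s\<close>. The only way that cancelling a shallow pair can
    remove \<open>x\<close> from the boundary of \<open>t\<close> is that \<open>x\<close> belongs to that pair.
  The letters of a word are pairwise disjoint, because cancelled cells are gone. So the first two
  facts allow a letter that is shallow at the start to be moved to the front without changing the
  relative order of the other letters (\<open>move_to_front\<close>): the words form an antimatroid. The third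
  fact turns it into the antimatroid of a poset. More concretely, it shows that if \<open>a\<close> is not
  shallow at the start, then some fixed pair precedes \<open>a\<close> in all words
  (\<open>blocked_by_fixed_pair\<close>). Therefore the first element of a linear extension of the intersection of all words is shallow. After it is
  cancelled, the words of the quotient are exactly the old words with that letter deleted, so that
  the induction proceeds (\<open>extension_is_word\<close>).

  This argument starts from some shallow order. If there is none, then the depth poset relates any
  two birth-death pairs in both directions, so a linear order can contain it only if there is at
  most one birth-death pair. The birth-death pair whose death comes first is always shallow
  (\<open>first_death_shallow\<close>), and so a single pair does form a shallow order.
\<close>

section \<open>Quotients by shallow pairs\<close>

lemma cells_quotient [simp]: "cells (quotient L p) = cells L - {fst p, snd p}"
  by (simp add: quotient_def case_prod_beta)

lemma inc_quotient [simp]: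
  "inc (quotient L p) y x =
     inc L y x - inverse (inc L (snd p) (fst p)) * inc L y (fst p) * inc L (snd p) x"
  by (simp add: quotient_def case_prod_beta)

lemma shallow_iff:
  "(s, t) \<in> SH L f \<longleftrightarrow> s \<in> cells L \<and> t \<in> cells L \<and> inc L t s \<noteq> 0 \<and>
     (\<forall>x\<in>cells L. inc L t x \<noteq> 0 \<longrightarrow> f x \<le> f s) \<and>
     (\<forall>y\<in>cells L. inc L y s \<noteq> 0 \<longrightarrow> f t \<le> f y)"
  by (auto simp: SH_def facet_def)

definition disjoint_pairs :: "'a \<times> 'a \<Rightarrow> 'a \<times> 'a \<Rightarrow> bool" where
  "disjoint_pairs p q \<longleftrightarrow> {fst p, snd p} \<inter> {fst q, snd q} = {}"

lemma disjoint_pairs_commute: "disjoint_pairs p q \<longleftrightarrow> disjoint_pairs q p"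
  by (auto simp: disjoint_pairs_def)

text \<open>
  For shallow \<open>(s, t)\<close> and \<open>(u, v)\<close>, the cell \<open>u\<close> can be a facet of \<open>t\<close> only if \<open>f u \<le> f s\<close>, and
  \<open>s\<close> can be a facet of \<open>v\<close> only if \<open>f s \<le> f u\<close>. By injectivity at most one of the two happens.
\<close>

lemma shallow_cross_term:
  assumes "inj_on f (cells L)" "(s, t) \<in> SH L f" "(u, v) \<in> SH L f" "s \<noteq> u"
  shows "inc L t u = 0 \<or> inc L v s = 0"
  using assms by (metis shallow_iff antisym inj_onD)

text \<open>
  Let \<open>p = (s, t)\<close> and \<open>q = (u, v)\<close>. The correction term of the quotient adds to the boundary of
  \<open>t\<close> only facets of \<open>v\<close>, and only if \<open>u\<close> is itself a facet of \<open>t\<close>; these cells come no later than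
  \<open>u\<close>, and \<open>u\<close> comes no later than \<open>s\<close>. By \<open>shallow_cross_term\<close>, \<open>inc L t s\<close> is unchanged. The
  coboundary of \<open>s\<close> behaves dually.
\<close>

lemma shallow_persists:
  assumes inj: "inj_on f (cells L)" and p: "p \<in> SH L f" and q: "q \<in> SH L f"
    and disj: "disjoint_pairs p q"
  shows "p \<in> SH (quotient L q) f"
proof -
  obtain s t u v where pq: "p = (s, t)" "q = (u, v)"
    by fastforce
  have cross: "inc L t u = 0 \<or> inc L v s = 0"
    using shallow_cross_term[OF inj] p q disj pq by (auto simp: disjoint_pairs_def)
  have P: "s \<in> cells L" "t \<in> cells L" "inc L t s \<noteq> 0"
    and Pf: "\<And>x. x \<in> cells L \<Longrightarrow> inc L t x \<noteq> 0 \<Longrightarrow> f x \<le> f s"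
    and Pc: "\<And>y. y \<in> cells L \<Longrightarrow> inc L y s \<noteq> 0 \<Longrightarrow> f t \<le> f y"
    using p pq by (auto simp: shallow_iff)
  have Q: "u \<in> cells L" "v \<in> cells L"
    and Qf: "\<And>x. x \<in> cells L \<Longrightarrow> inc L v x \<noteq> 0 \<Longrightarrow> f x \<le> f u"
    and Qc: "\<And>y. y \<in> cells L \<Longrightarrow> inc L y u \<noteq> 0 \<Longrightarrow> f v \<le> f y"
    using q pq by (auto simp: shallow_iff)
  have "f x \<le> f s" if x: "x \<in> cells L" "inc (quotient L q) t x \<noteq> 0" for x
  proof (cases "inc L t x = 0")
    case True
    then have "inc L t u \<noteq> 0" "inc L v x \<noteq> 0"
      using x pq by auto
    then show ?thesis
      using Pf[of u] Qf[of x] x Q by simp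
  qed (use Pf x in blast)
  moreover have "f t \<le> f y" if y: "y \<in> cells L" "inc (quotient L q) y s \<noteq> 0" for y
  proof (cases "inc L y s = 0")
    case True
    then have "inc L y u \<noteq> 0" "inc L v s \<noteq> 0"
      using y pq by auto
    then show ?thesis
      using Pc[of v] Qc[of y] y Q by simp
  qed (use Pc y in blast)
  moreover have "inc (quotient L q) t s \<noteq> 0"
    using cross P pq by auto
  ultimately show ?thesis
    using P disj pq by (auto simp: shallow_iff disjoint_pairs_def simp del: inc_quotient)
qed

text \<open>
  Both sides are the Schur complement of the incidence matrix with respect to the two by two block
  of the two pairs. This block is triangular by \<open>shallow_cross_term\<close>.
\<close>

lemma quotient_commute:
  assumes inj: "inj_on f (cells L)" and p: "p \<in> SH L f" and q: "q \<in> SH L f"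
    and disj: "disjoint_pairs p q"
  shows "quotient (quotient L p) q = quotient (quotient L q) p"
proof -
  obtain s t u v where pq: "p = (s, t)" "q = (u, v)"
    by fastforce
  have cross: "inc L t u = 0 \<or> inc L v s = 0"
    using shallow_cross_term[OF inj] p q disj pq by (auto simp: disjoint_pairs_def)
  have nz: "inc L t s \<noteq> 0" "inc L v u \<noteq> 0"
    using p q pq by (auto simp: shallow_iff)
  have "inc (quotient (quotient L p) q) y x = inc (quotient (quotient L q) p) y x" for y x
    using cross nz pq by (auto simp: field_simps)
  then have "inc (quotient (quotient L p) q) = inc (quotient (quotient L q) p)"
    by blast
  moreover have "cells (quotient (quotient L p) q) = cells (quotient (quotient L q) p)"
    by auto
  moreover have "cdim (quotient (quotient L p) q) = cdim (quotient (quotient L q) p)"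
    by (simp add: quotient_def case_prod_beta)
  ultimately show ?thesis
    by (simp add: incidence_complex.equality)
qed

text \<open>
  Let \<open>x\<close> be the last facet of \<open>t\<close>. If \<open>x\<close> comes after \<open>s\<close>, it has to leave the boundary of \<open>t\<close>.
  Cancelling a shallow pair \<open>(u, v)\<close> modifies that boundary only if \<open>u\<close> is a facet of \<open>t\<close>, and then
  only in facets of \<open>v\<close>, which come no later than \<open>u\<close>, which comes no later than \<open>x\<close>. So only
  \<open>u = x\<close> or the removal of \<open>x = v\<close> can help.
\<close>

lemma unlocks_last_facet:
  assumes inj: "inj_on f (cells L)" and q: "q \<in> SH L f"
    and pq: "(s, t) \<in> SH (quotient L q) f"
    and x: "x \<in> cells L" "inc L t x \<noteq> 0" "f s < f x"
    and last: "\<And>z. z \<in> cells L \<Longrightarrow> inc L t z \<noteq> 0 \<Longrightarrow> f z \<le> f x"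
  shows "x \<in> {fst q, snd q}"
proof (rule ccontr)
  obtain u v where uv: "q = (u, v)"
    by fastforce
  assume "x \<notin> {fst q, snd q}"
  then have "x \<in> cells (quotient L q)" "x \<noteq> u"
    using x uv by auto
  then have "inc (quotient L q) t x = 0"
    using pq x by (force simp: shallow_iff simp del: inc_quotient)
  then have "inc L t u \<noteq> 0" "inc L v x \<noteq> 0"
    using x uv by auto
  then have "f x = f u"
    using last[of u] q uv x by (fastforce simp: shallow_iff intro: antisym)
  then show False
    using \<open>x \<noteq> u\<close> inj q uv x by (auto simp: shallow_iff inj_on_def)
qed

lemma unlocks_first_cofacet:
  assumes inj: "inj_on f (cells L)" and q: "q \<in> SH L f"
    and pq: "(s, t) \<in> SH (quotient L q) f"
    and y: "y \<in> cells L" "inc L y s \<noteq> 0" "f y < f t"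
    and first: "\<And>z. z \<in> cells L \<Longrightarrow> inc L z s \<noteq> 0 \<Longrightarrow> f y \<le> f z"
  shows "y \<in> {fst q, snd q}"
proof (rule ccontr)
  obtain u v where uv: "q = (u, v)"
    by fastforce
  assume "y \<notin> {fst q, snd q}"
  then have "y \<in> cells (quotient L q)" "y \<noteq> v"
    using y uv by auto
  then have "inc (quotient L q) y s = 0"
    using pq y by (force simp: shallow_iff simp del: inc_quotient)
  then have "inc L y u \<noteq> 0" "inc L v s \<noteq> 0"
    using y uv by auto
  then have "f y = f v"
    using first[of v] q uv y by (fastforce simp: shallow_iff intro: antisym)
  then show False
    using \<open>y \<noteq> v\<close> inj q uv y by (auto simp: shallow_iff inj_on_def)
qed

lemma obtains_maximizer:
  fixes f :: "'a \<Rightarrow> 'b::linorder"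
  assumes "finite A" "a \<in> A"
  obtains m where "m \<in> A" "\<And>x. x \<in> A \<Longrightarrow> f x \<le> f m"
proof -
  have "Max (f ` A) \<in> f ` A"
    using assms by (intro Max_in) auto
  then obtain m where "m \<in> A" "f m = Max (f ` A)"
    by auto
  then show thesis
    using that assms(1) by (metis Max_ge finite_imageI imageI)
qed

text \<open>
  Write \<open>p = (s, t)\<close> and \<open>q = (u, v)\<close>. If \<open>p\<close> is not shallow, then the last facet of \<open>t\<close> comes
  after \<open>s\<close>, or the first cofacet of \<open>s\<close> comes before \<open>t\<close>, or both of these are in order and only
  \<open>inc L t s \<noteq> 0\<close> fails. In the first two cases, if both cancellations unlocked \<open>p\<close>, the offending
  cell would belong to both \<open>q\<close> and \<open>r\<close>. In the third case no cancellation of a shallow pair helps: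
  the correction to \<open>inc L t s\<close> is non-zero only if \<open>u\<close> is a facet of \<open>t\<close> and \<open>s\<close> is a facet of \<open>v\<close>,
  and then \<open>u\<close> is a facet of \<open>t\<close> after \<open>s\<close>.
\<close>

lemma unique_unlocking:
  assumes fin: "finite (cells L)" and inj: "inj_on f (cells L)"
    and q: "q \<in> SH L f" and r: "r \<in> SH L f" and disj: "disjoint_pairs q r"
    and p: "p \<notin> SH L f" and pq: "p \<in> SH (quotient L q) f"
  shows "p \<notin> SH (quotient L r) f"
proof
  assume pr: "p \<in> SH (quotient L r) f"
  obtain s t where st: "p = (s, t)"
    by fastforce
  obtain u v where uv: "q = (u, v)"
    by fastforce
  have cells: "s \<in> cells L" "t \<in> cells L" "s \<noteq> u"
    using pq st uv by (auto simp: shallow_iff)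
  have facets: "f x \<le> f s" if x: "x \<in> cells L" "inc L t x \<noteq> 0" for x
  proof (rule ccontr)
    assume late: "\<not> f x \<le> f s"
    obtain m where m: "m \<in> {z \<in> cells L. inc L t z \<noteq> 0}"
      and last: "\<And>z. z \<in> {z \<in> cells L. inc L t z \<noteq> 0} \<Longrightarrow> f z \<le> f m"
      using obtains_maximizer[of "{z \<in> cells L. inc L t z \<noteq> 0}" x f] fin x by auto
    have "f s < f m"
      using late last[of x] x by simp
    then have "m \<in> {fst q, snd q}" "m \<in> {fst r, snd r}"
      using unlocks_last_facet[OF inj q, of s t m] unlocks_last_facet[OF inj r, of s t m]
        pq pr st m last by blast+
    then show False
      using disj by (auto simp: disjoint_pairs_def)
  qed
  have cofacets: "f t \<le> f y" if y: "y \<in> cells L" "inc L y s \<noteq> 0" for y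
  proof (rule ccontr)
    assume early: "\<not> f t \<le> f y"
    obtain m where m: "m \<in> {z \<in> cells L. inc L z s \<noteq> 0}"
      and first: "\<And>z. z \<in> {z \<in> cells L. inc L z s \<noteq> 0} \<Longrightarrow> f m \<le> f z"
      using obtains_maximizer[of "{z \<in> cells L. inc L z s \<noteq> 0}" y "\<lambda>z. - f z"] fin y by auto
    have "f m < f t"
      using early first[of y] y by simp
    then have "m \<in> {fst q, snd q}" "m \<in> {fst r, snd r}"
      using unlocks_first_cofacet[OF inj q, of s t m] unlocks_first_cofacet[OF inj r, of s t m]
        pq pr st m first by blast+
    then show False
      using disj by (auto simp: disjoint_pairs_def)
  qed
  have "inc L t s = 0"
    using p st cells facets cofacets by (auto simp: shallow_iff)
  then have "inc L t u \<noteq> 0" "inc L v s \<noteq> 0"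
    using pq st uv by (auto simp: shallow_iff)
  then have "f u = f s"
    using facets[of u] q uv cells by (fastforce simp: shallow_iff intro: antisym)
  then show False
    using inj q uv cells by (auto simp: shallow_iff inj_on_def)
qed

section \<open>Cancellation words\<close>

fun cancels :: "('a, 'k::field) incidence_complex \<Rightarrow> ('a \<Rightarrow> real) \<Rightarrow> ('a \<times> 'a) list \<Rightarrow> bool" where
  "cancels L f [] \<longleftrightarrow> True"
| "cancels L f (p # w) \<longleftrightarrow> p \<in> SH L f \<and> cancels (quotient L p) f w"

lemma cancels_iff_nth:
  "cancels L f w \<longleftrightarrow> (\<forall>i<length w. w ! i \<in> SH (foldl quotient L (take i w)) f)"
  by (induction w arbitrary: L) (auto simp: All_less_Suc2)

lemma cancels_cells: "cancels L f w \<Longrightarrow> p \<in> set w \<Longrightarrow> fst p \<in> cells L \<and> snd p \<in> cells L"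
  by (induction w arbitrary: L) (fastforce simp: shallow_iff)+

lemma cancels_disjoint_head:
  assumes "cancels L f (p # w)" "q \<in> set w"
  shows "disjoint_pairs q p"
  using cancels_cells[of "quotient L p" f w q] assms by (auto simp: disjoint_pairs_def)

lemma cancels_disjoint:
  "cancels L f w \<Longrightarrow> p \<in> set w \<Longrightarrow> q \<in> set w \<Longrightarrow> p \<noteq> q \<Longrightarrow> disjoint_pairs p q"
proof (induction w arbitrary: L)
  case (Cons a w)
  have head: "disjoint_pairs b a" "disjoint_pairs a b" if "b \<in> set w" for b
    using cancels_disjoint_head[OF Cons.prems(1) that] disjoint_pairs_commute by blast+
  show ?case
    using Cons head by (cases "p = a"; cases "q = a") auto
qed simp

lemma cancels_distinct: "cancels L f w \<Longrightarrow> distinct w"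
proof (induction w arbitrary: L)
  case (Cons a w)
  have "a \<notin> set w"
    using cancels_disjoint_head[OF Cons.prems, of a] by (auto simp: disjoint_pairs_def)
  then show ?case
    using Cons by auto
qed simp

lemma move_to_front:
  assumes "inj_on f (cells L)" "cancels L f w" "p \<in> set w" "p \<in> SH L f"
  shows "cancels L f (p # remove1 p w)"
  using assms
proof (induction w arbitrary: L)
  case (Cons a w)
  show ?case
  proof (cases "p = a")
    case True
    then show ?thesis
      using Cons.prems by simp
  next
    case False
    then have p: "p \<in> set w"
      using Cons.prems by simp
    have a: "a \<in> SH L f" "cancels (quotient L a) f w"
      using Cons.prems by auto
    have disj: "disjoint_pairs p a" "disjoint_pairs a p"
      using cancels_disjoint_head[OF Cons.prems(2) p] disjoint_pairs_commute by blast+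
    have "p \<in> SH (quotient L a) f" "a \<in> SH (quotient L p) f"
      using shallow_persists Cons.prems(1,4) a(1) disj by blast+
    moreover have "inj_on f (cells (quotient L a))"
      using Cons.prems(1) by (auto intro: inj_on_subset)
    ultimately have "cancels (quotient L a) f (p # remove1 p w)"
      using Cons.IH a(2) p by blast
    then show ?thesis
      using quotient_commute[OF Cons.prems(1) a(1) Cons.prems(4) disj(2)]
        \<open>a \<in> SH (quotient L p) f\<close> False Cons.prems(4) by simp
  qed
qed simp

definition words ::
  "('a, 'k::field) incidence_complex \<Rightarrow> ('a \<Rightarrow> real) \<Rightarrow> ('a \<times> 'a) set \<Rightarrow> ('a \<times> 'a) list set" where
  "words L f P = {w. cancels L f w \<and> set w = P}"

lemma Cons_in_words:
  assumes "p # w \<in> words L f P"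
  shows "p \<in> SH L f" "w \<in> words (quotient L p) f (P - {p})"
  using assms cancels_distinct[of L f "p # w"] by (auto simp: words_def)

lemma remove1_in_words:
  assumes "inj_on f (cells L)" "p \<in> SH L f" "p \<in> P" "w \<in> words L f P"
  shows "remove1 p w \<in> words (quotient L p) f (P - {p})"
  using assms move_to_front[of f L w p] cancels_distinct[of L f w] by (auto simp: words_def)

section \<open>Orders given by enumerations\<close>

lemma enumeration_order_Cons:
  "enumeration_order (x # xs) = {x} \<times> set (x # xs) \<union> enumeration_order xs" (is "?l = ?r")
proof
  show "?l \<subseteq> ?r"
  proof
    fix c assume "c \<in> ?l"
    then obtain i j where ij: "c = ((x # xs) ! i, (x # xs) ! j)" "i \<le> j" "j < length (x # xs)"
      unfolding enumeration_order_def by blast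
    show "c \<in> ?r"
    proof (cases i)
      case 0
      then show ?thesis
        using ij nth_mem[of j "x # xs"] by (simp del: list.set)
    next
      case (Suc i')
      then obtain j' where "j = Suc j'"
        using ij by (cases j) auto
      then show ?thesis
        using ij Suc unfolding enumeration_order_def by auto
    qed
  qed
  have "(x, y) \<in> ?l" if y: "y \<in> set (x # xs)" for y
  proof -
    obtain j where "j < length (x # xs)" "y = (x # xs) ! j"
      using y by (metis in_set_conv_nth)
    then show ?thesis
      unfolding enumeration_order_def by (intro CollectI exI[where x = 0] exI[where x = j]) simp
  qed
  moreover have "enumeration_order xs \<subseteq> ?l"
  proof
    fix c assume "c \<in> enumeration_order xs"
    then obtain i j where "c = (xs ! i, xs ! j)" "i \<le> j" "j < length xs"
      unfolding enumeration_order_def by blast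
    then show "c \<in> ?l"
      unfolding enumeration_order_def
      by (intro CollectI exI[where x = "Suc i"] exI[where x = "Suc j"]) simp
  qed
  ultimately show "?r \<subseteq> ?l"
    by blast
qed

lemma enumeration_order_subset: "enumeration_order xs \<subseteq> set xs \<times> set xs"
  unfolding enumeration_order_def by auto

lemma enumeration_order_remove1: "enumeration_order (remove1 a xs) \<subseteq> enumeration_order xs"
proof (induction xs)
  case (Cons x xs)
  then show ?case
    using set_remove1_subset[of a xs] by (auto simp: enumeration_order_Cons)
qed simp

lemma finite_linear_order_enumeration:
  assumes "finite A" "linear_order_on A r"
  obtains xs where "distinct xs" "set xs = A" "r = enumeration_order xs"
proof -
  have "\<exists>xs. distinct xs \<and> set xs = A \<and> r = enumeration_order xs"
    using assms
  proof (induction A arbitrary: r rule: finite_psubset_induct)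
    case (psubset A)
    show ?case
    proof (cases "A = {}")
      case True
      then show ?thesis
        using psubset.prems by (intro exI[of _ "[]"]) (auto simp: order_on_defs enumeration_order_def)
    next
      case False
      have lin: "r \<subseteq> A \<times> A" "refl_on A r" "trans r" "antisym r" "total_on A r"
        using psubset.prems by (auto simp: order_on_defs)
      have "asymp_on A (\<lambda>x y. (x, y) \<in> r - Id)" "transp_on A (\<lambda>x y. (x, y) \<in> r - Id)"
        using lin(3,4) by (auto simp: asymp_on_def transp_on_def dest: antisymD transD)
      then obtain m where m: "m \<in> A" "\<forall>x\<in>A. x \<noteq> m \<longrightarrow> (x, m) \<notin> r"
        using Finite_Set.bex_min_element[OF psubset.hyps] False by fastforce
      have least: "(m, x) \<in> r" if "x \<in> A" for x
        using m that lin(2,5) by (cases "x = m") (auto simp: refl_on_def total_on_def)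
      define r' where "r' = r \<inter> (A - {m}) \<times> (A - {m})"
      have "linear_order_on (A - {m}) r'"
        using lin unfolding r'_def order_on_defs refl_on_def trans_def antisym_def total_on_def
        by blast
      then obtain xs where xs: "distinct xs" "set xs = A - {m}" "r' = enumeration_order xs"
        using psubset.IH[of "A - {m}"] m(1) by blast
      have "r = {m} \<times> A \<union> r'"
        using lin(1) least m(2) unfolding r'_def by auto
      then have "r = enumeration_order (m # xs)"
        using xs m(1) by (simp add: enumeration_order_Cons insert_absorb)
      then show ?thesis
        using xs m(1) by (intro exI[of _ "m # xs"]) auto
    qed
  qed
  then show thesis
    using that by blast
qed

section \<open>Words and the intersection of their orders\<close>

text \<open>
  Induction on the length of the word: as long as some first move \<open>c\<close> leaves \<open>a\<close> blocked, cancel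
  \<open>c\<close>. By \<open>remove1_in_words\<close>, a pair that precedes \<open>a\<close> in all words of the quotient
  precedes \<open>a\<close> in all original words. If every first move unlocks \<open>a\<close>, then by \<open>unique_unlocking\<close>
  there is only one first move, and this is the pair sought.
\<close>

lemma blocked_by_fixed_pair:
  assumes "finite (cells L)" "inj_on f (cells L)"
    and "w \<in> words L f P" "a \<in> P" "a \<notin> SH L f"
  shows "\<exists>b\<in>P. b \<noteq> a \<and> (\<forall>v\<in>words L f P. (b, a) \<in> enumeration_order v)"
  using assms
proof (induction "length w" arbitrary: w L P)
  case 0
  then show ?case
    by (simp add: words_def)
next
  case (Suc n)
  show ?case
  proof (cases "\<exists>c\<in>P. c \<in> SH L f \<and> a \<notin> SH (quotient L c) f")
    case True
    then obtain c where c: "c \<in> P" "c \<in> SH L f" "a \<notin> SH (quotient L c) f"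
      by blast
    have rem: "remove1 c v \<in> words (quotient L c) f (P - {c})" if "v \<in> words L f P" for v
      using remove1_in_words Suc.prems(2) c that by blast
    have "n = length (remove1 c w)"
      using Suc.hyps(2) Suc.prems(3) c(1) by (auto simp: length_remove1 words_def)
    moreover have "finite (cells (quotient L c))" "inj_on f (cells (quotient L c))"
      using Suc.prems(1,2) by (auto intro: inj_on_subset)
    moreover have "a \<in> P - {c}"
      using c(2) Suc.prems(4,5) by auto
    ultimately obtain b where b: "b \<in> P - {c}" "b \<noteq> a"
      "\<And>v. v \<in> words (quotient L c) f (P - {c}) \<Longrightarrow> (b, a) \<in> enumeration_order v"
      using Suc.hyps(1)[of "remove1 c w" "quotient L c" "P - {c}"] rem[OF Suc.prems(3)] c(3)
      by blast
    have "(b, a) \<in> enumeration_order v" if "v \<in> words L f P" for v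
      by (rule subsetD[OF enumeration_order_remove1 b(3)[OF rem[OF that]]])
    then show ?thesis
      using b by blast
  next
    case False
    obtain c w' where w: "w = c # w'"
      using Suc.hyps(2) by (cases w) auto
    have c: "c \<in> P" "c \<in> SH L f"
      using Suc.prems(3) w by (auto simp: words_def)
    have "(c, a) \<in> enumeration_order v" if v: "v \<in> words L f P" for v
    proof -
      obtain d v' where d: "v = d # v'"
        using v Suc.prems(4) by (cases v) (auto simp: words_def)
      have dP: "d \<in> P" "d \<in> SH L f"
        using v d by (auto simp: words_def)
      have "d = c"
      proof (rule ccontr)
        assume "d \<noteq> c"
        then have "disjoint_pairs d c"
          using cancels_disjoint[of L f w d c] Suc.prems(3) c dP by (auto simp: words_def)
        then show False
          using unique_unlocking[OF Suc.prems(1,2) dP(2) c(2)] False c dP Suc.prems(5) by blast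
      qed
      then show ?thesis
        using d v Suc.prems(4) by (auto simp: enumeration_order_Cons words_def)
    qed
    moreover have "c \<noteq> a"
      using c(2) Suc.prems(5) by auto
    ultimately show ?thesis
      using c(1) by (intro bexI[of _ c]) auto
  qed
qed

text \<open>
  The first letter \<open>a\<close> of \<open>u\<close> is shallow, for otherwise a fixed pair would precede \<open>a\<close> in all words
  and hence in \<open>u\<close>. Deleting \<open>a\<close> maps words of \<open>L\<close> to words of the quotient by \<open>a\<close>, so a relation
  common to all words of the quotient is common to all words of \<open>L\<close>. The hypothesis on \<open>u\<close> thus
  passes to its tail.
\<close>

lemma extension_is_word:
  assumes "finite (cells L)" "inj_on f (cells L)" "w \<in> words L f P"
    and "distinct u" "set u = P"
    and "\<And>b c. \<forall>v\<in>words L f P. (b, c) \<in> enumeration_order v \<Longrightarrow> (b, c) \<in> enumeration_order u"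
  shows "cancels L f u"
  using assms
proof (induction u arbitrary: L P w)
  case (Cons a u)
  have a: "a \<in> SH L f"
  proof (rule ccontr)
    assume "a \<notin> SH L f"
    then obtain b where b: "b \<noteq> a" "\<forall>v\<in>words L f P. (b, a) \<in> enumeration_order v"
      using blocked_by_fixed_pair[OF Cons.prems(1-3), of a] Cons.prems(5) by auto
    have "(b, a) \<in> enumeration_order (a # u)"
      by (rule Cons.prems(6)) (rule b(2))
    then show False
      using b(1) Cons.prems(4) enumeration_order_subset[of u] by (auto simp: enumeration_order_Cons)
  qed
  have aP: "a \<in> P"
    using Cons.prems(5) by auto
  have rem: "remove1 a v \<in> words (quotient L a) f (P - {a})" if "v \<in> words L f P" for v
    using remove1_in_words Cons.prems(2) a aP that by blast
  have "cancels (quotient L a) f u"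
  proof (rule Cons.IH)
    show "finite (cells (quotient L a))" "inj_on f (cells (quotient L a))"
      using Cons.prems(1,2) by (auto intro: inj_on_subset)
    show "remove1 a w \<in> words (quotient L a) f (P - {a})"
      by (rule rem) (rule Cons.prems(3))
    show "distinct u" "set u = P - {a}"
      using Cons.prems(4,5) by auto
    fix b c
    assume all: "\<forall>v\<in>words (quotient L a) f (P - {a}). (b, c) \<in> enumeration_order v"
    then have "\<forall>v\<in>words L f P. (b, c) \<in> enumeration_order v"
      using rem by (auto intro: subsetD[OF enumeration_order_remove1])
    then have "(b, c) \<in> enumeration_order (a # u)"
      by (rule Cons.prems(6))
    moreover have "b \<in> P - {a}"
      using all rem[OF Cons.prems(3)] enumeration_order_subset[of "remove1 a w"]
      unfolding words_def by blast
    ultimately show "(b, c) \<in> enumeration_order u"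
      by (auto simp: enumeration_order_Cons)
  qed
  then show ?case
    using a by simp
qed simp

section \<open>Birth-death pairs\<close>

lemma BD_subset: "BD L f \<subseteq> cells L \<times> cells L"
  by (auto simp: BD_def pivot_def)

text \<open>
  If \<open>t\<close> is the first death, then all earlier columns of the reduced form \<open>R\<close> vanish, hence
  so do all earlier columns of the boundary matrix, since they arise from those of \<open>R\<close> by a
  unitriangular change of basis. So no cell before \<open>t\<close> is a cofacet of anything, and column \<open>t\<close> of
  the boundary matrix is column \<open>t\<close> of \<open>R\<close>, whose lowest entry is in row \<open>s\<close>.
\<close>

lemma first_death_shallow:
  assumes fin: "finite (cells L)" and st: "(s, t) \<in> BD L f"
    and first: "\<And>s' t'. (s', t') \<in> BD L f \<Longrightarrow> f t \<le> f t'"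
  shows "(s, t) \<in> SH L f"
proof -
  obtain R where red: "reduced_form L f R" and piv: "pivot L f R s t"
    using st by (auto simp: BD_def)
  obtain V where
    V: "\<And>x y. x \<in> cells L \<Longrightarrow> y \<in> cells L \<Longrightarrow> V x y - (if x = y then 1 else 0) \<noteq> 0 \<Longrightarrow> f x < f y"
    and R: "\<And>x y. x \<in> cells L \<Longrightarrow> y \<in> cells L \<Longrightarrow> R x y = (\<Sum>z\<in>cells L. inc L z x * V z y)"
    using red unfolding reduced_form_def strictly_upper_def boundary_matrix_def by blast
  have column: "inc L y x = R x y"
    if x: "x \<in> cells L" and y: "y \<in> cells L"
      and zero: "\<And>z. z \<in> cells L \<Longrightarrow> f z < f y \<Longrightarrow> inc L z x = 0" for x y
  proof -
    have "V y y = 1"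
      using V[OF y y] by auto
    moreover have "inc L z x * V z y = 0" if "z \<in> cells L - {y}" for z
      using V[of z y] zero[of z] y that by auto
    ultimately show ?thesis
      using R[OF x y] sum.neutral[of "cells L - {y}" "\<lambda>z. inc L z x * V z y"]
      by (simp add: sum.remove[OF fin y])
  qed
  have R_zero: "R x y = 0" if x: "x \<in> cells L" and y: "y \<in> cells L" "f y < f t" for x y
  proof (rule ccontr)
    assume nz: "R x y \<noteq> 0"
    obtain m where m: "m \<in> {z \<in> cells L. R z y \<noteq> 0}"
      and last: "\<And>z. z \<in> {z \<in> cells L. R z y \<noteq> 0} \<Longrightarrow> f z \<le> f m"
      using obtains_maximizer[of "{z \<in> cells L. R z y \<noteq> 0}" x f] fin x nz by auto
    then have "pivot L f R m y"
      using y(1) unfolding pivot_def by force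
    then show False
      using red first[of m y] y(2) by (auto simp: BD_def)
  qed
  have early: "inc L y x = 0" if "y \<in> cells L" "f y < f t" "x \<in> cells L" for x y
    using that
  proof (induction "card {z \<in> cells L. f z < f y}" arbitrary: y rule: less_induct)
    case less
    have "inc L z x = 0" if z: "z \<in> cells L" "f z < f y" for z
    proof (rule less.hyps)
      show "card {a \<in> cells L. f a < f z} < card {a \<in> cells L. f a < f y}"
        using z fin by (intro psubset_card_mono) auto
    qed (use z less.prems in auto)
    then show ?case
      using column R_zero less.prems by metis
  qed
  have t: "t \<in> cells L"
    using piv by (simp add: pivot_def)
  have "inc L t x = R x t" if "x \<in> cells L" for x
    using column early t that by blast
  then show ?thesis
    using piv early unfolding shallow_iff pivot_def by (metis not_le)
qed

section \<open>Shallow orders and linear extensions\<close>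

lemma shallow_enumeration_iff_words: "shallow_enumeration L f w \<longleftrightarrow> w \<in> words L f (BD L f)"
  using cancels_distinct by (auto simp: shallow_enumeration_def words_def cancels_iff_nth)

lemma depth_poset_iff:
  "(b, c) \<in> depth_poset L f \<longleftrightarrow> b \<in> BD L f \<and> c \<in> BD L f \<and>
     (\<forall>w\<in>words L f (BD L f). (b, c) \<in> enumeration_order w)"
  by (auto simp: depth_poset_def shallow_order_def shallow_enumeration_iff_words)

theorem proposition7p6:
  fixes L :: "('a, 'k::field) incidence_complex"
    and f :: "'a \<Rightarrow> real"
    and \<Phi> :: "('a \<times> 'a) rel"
  assumes "lefschetz_complex L"
    and "complex_filter L f"
    and "linear_order_on (BD L f) \<Phi>"
  shows "shallow_order L f \<Phi> \<longleftrightarrow> linear_extension (BD L f) (depth_poset L f) \<Phi>"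
proof
  assume "shallow_order L f \<Phi>"
  then show "linear_extension (BD L f) (depth_poset L f) \<Phi>"
    using assms(3) by (auto simp: linear_extension_def depth_poset_def)
next
  assume "linear_extension (BD L f) (depth_poset L f) \<Phi>"
  then have ext: "depth_poset L f \<subseteq> \<Phi>"
    by (simp add: linear_extension_def)
  have fin: "finite (cells L)" and inj: "inj_on f (cells L)"
    using assms(1,2) by (auto simp: lefschetz_complex_def complex_filter_def)
  have "finite (BD L f)"
    using BD_subset fin by (metis finite_SigmaI finite_subset)
  then obtain u where u: "distinct u" "set u = BD L f" "\<Phi> = enumeration_order u"
    using finite_linear_order_enumeration assms(3) by blast
  have "cancels L f u"
  proof (cases "words L f (BD L f) = {}")
    case False
    then obtain w where w: "w \<in> words L f (BD L f)"
      by blast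
    show ?thesis
    proof (rule extension_is_word[OF fin inj w u(1,2)])
      fix b c
      assume all: "\<forall>v\<in>words L f (BD L f). (b, c) \<in> enumeration_order v"
      then have "b \<in> BD L f \<and> c \<in> BD L f"
        using w enumeration_order_subset[of w] unfolding words_def by blast
      then show "(b, c) \<in> enumeration_order u"
        using all ext u(3) by (auto simp: depth_poset_iff)
    qed
  next
    case True
    then have total: "(b, c) \<in> \<Phi>" if "b \<in> BD L f" "c \<in> BD L f" for b c
      using ext that by (auto simp: depth_poset_iff)
    have "antisym \<Phi>"
      using assms(3) by (simp add: order_on_defs)
    then have eq: "b = c" if "b \<in> BD L f" "c \<in> BD L f" for b c
      using antisymD[OF _ total[OF that] total[OF that(2) that(1)]] by simp
    show ?thesis
    proof (cases u)
      case (Cons p v)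
      have "set v \<subseteq> {p}"
        using eq[of _ p] u(2) Cons by auto
      then have "v = []"
        using u(1) Cons by (cases v) auto
      moreover have "p \<in> SH L f"
      proof -
        have p: "(fst p, snd p) \<in> BD L f"
          using u(2) Cons by auto
        have "(fst p, snd p) \<in> SH L f"
        proof (rule first_death_shallow[OF fin p])
          show "f (snd p) \<le> f t'" if "(s', t') \<in> BD L f" for s' t'
            using eq[OF p that] by simp
        qed
        then show ?thesis
          by simp
      qed
      ultimately show ?thesis
        using Cons by simp
    qed simp
  qed
  then have "shallow_enumeration L f u"
    using u(2) by (simp add: shallow_enumeration_iff_words words_def)
  then show "shallow_order L f \<Phi>"
    using u(3) by (auto simp: shallow_order_def)
qed

end
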